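(* For all integers $n, m, k$ with $n \geq 1$, $1 \leq k \leq n$ and $0 \leq m \leq n$, we have $$p^{UU}_{n,m,k}=p^{DD}_{n,n-m,n-k},\qquad p^{UD}_{n,m,k}=p^{DU}_{n,n-m,n-k},\qquad p_{n,m,k}=p_{n,n-m,n-k}.$$
   Context: Let $\mathcal{L}_n$ be the set of lattice paths in $\mathbb{Z}\times\mathbb{Z}$ from $(0,0)$ to $(n,n)$ using up steps $U=(0,1)$ and down steps $D=(1,0)$. A path is identified with a word of length $2n$ in the letters $U, D$ (with $n$ of each). An up step lies below the line $y=x$ if it goes from $(a,b)$ to $(a,b+1)$ with $b<a$. An $(n,m)$-Dyck path is a path in $\mathcal{L}_n$ with exactly $m$ up steps below the line $y=x$. A peak of a path is an occurrence of two consecutive steps $UD$. $\mathcal{P}_{n,m,k}$ denotes the set of all $(n,m)$-Dyck paths with exactly $k$ peaks, and $p_{n,m,k}=|\mathcal{P}_{n,m,k}|$. For $A,B\in\{U,D\}$, $\mathcal{P}^{AB}_{n,m,k}$ denotes the set of paths in $\mathcal{P}_{n,m,k}$ whose first step is $A$ and whose last step is $B$, and $p^{AB}_{n,m,k}=|\mathcal{P}^{AB}_{n,m,k}|$. *)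

theory Defs
  imports Main
begin

datatype step = U | D

text \<open>A path is a word in \<open>U = (0,1)\<close> and \<open>D = (1,0)\<close>, starting at the origin;
  \<open>vertex w i\<close> is the lattice point reached after the first \<open>i\<close> steps.\<close>

definition vertex :: "step list \<Rightarrow> nat \<Rightarrow> nat \<times> nat" where
  "vertex w i = (count_list (take i w) D, count_list (take i w) U)"

definition lattice_paths :: "nat \<Rightarrow> step list set" where
  "lattice_paths n = {w. vertex w (length w) = (n, n)}"

definition ups_below :: "step list \<Rightarrow> nat" where
  "ups_below w = card {i. i < length w \<and> w ! i = U \<and> snd (vertex w i) < fst (vertex w i)}"

definition peaks :: "step list \<Rightarrow> nat" where
  "peaks w = card {i. Suc i < length w \<and> w ! i = U \<and> w ! Suc i = D}"

definition dyck_paths :: "nat \<Rightarrow> nat \<Rightarrow> step list set" where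
  "dyck_paths n m = {w \<in> lattice_paths n. ups_below w = m}"

definition P :: "nat \<Rightarrow> nat \<Rightarrow> nat \<Rightarrow> step list set" where
  "P n m k = {w \<in> dyck_paths n m. peaks w = k}"

definition p :: "nat \<Rightarrow> nat \<Rightarrow> nat \<Rightarrow> nat" where
  "p n m k = card (P n m k)"

definition P_ends :: "step \<Rightarrow> step \<Rightarrow> nat \<Rightarrow> nat \<Rightarrow> nat \<Rightarrow> step list set" where
  "P_ends A B n m k = {w \<in> P n m k. w \<noteq> [] \<and> hd w = A \<and> last w = B}"

definition p_ends :: "step \<Rightarrow> step \<Rightarrow> nat \<Rightarrow> nat \<Rightarrow> nat \<Rightarrow> nat" where
  "p_ends A B n m k = card (P_ends A B n m k)"

text \<open>All these sets are finite, so the cardinalities above are genuine counts.\<close>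

lemma length_lattice_path: "w \<in> lattice_paths n \<Longrightarrow> length w = 2 * n"
proof -
  have "length v = count_list v D + count_list v U" for v
  proof (induction v)
    case (Cons a v)
    then show ?case by (cases a) auto
  qed simp
  then show "w \<in> lattice_paths n \<Longrightarrow> length w = 2 * n"
    by (simp add: lattice_paths_def vertex_def)
qed

lemma finite_lattice_paths: "finite (lattice_paths n)"
proof -
  have "x \<in> {U, D}" for x by (cases x) auto
  then have "lattice_paths n \<subseteq> {w. set w \<subseteq> {U, D} \<and> length w = 2 * n}"
    using length_lattice_path by blast
  then show ?thesis
    by (rule finite_subset) (rule finite_lists_length_eq, simp)
qed

end

theory Submission
  imports Defs
begin

text \<open>
  A path from \<open>(0,0)\<close> to \<open>(n,n)\<close> is determined by its peaks. Record a peak by the column of its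
  down step and the row of its up step, both numbered from \<open>0\<close> to \<open>n - 1\<close>. A path with \<open>k\<close> peaks
  then corresponds to an arbitrary pair \<open>(A, B)\<close> of \<open>k\<close>-element subsets of \<open>{0, \<dots>, n - 1}\<close>, since
  the \<open>i\<close>-th peak has to use the \<open>i\<close>-th smallest column together with the \<open>i\<close>-th smallest row.
  Replacing both sets by their complements is an involution, and this one map proves all three
  identities.

  It clearly turns \<open>k\<close> into \<open>n - k\<close>. The path starts with \<open>U\<close> iff \<open>0 \<in> A\<close> and ends with \<open>D\<close> iff
  \<open>n - 1 \<in> B\<close>, so both end steps are exchanged. Finally, the up step in row \<open>j\<close> lies on the
  vertical line given by the next unused peak column, or on the line \<open>x = n\<close> if there is none.
  Hence it starts to the right of column \<open>j\<close>, that is, below the diagonal, iff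
  \[ |A \<inter> [0, j]| \<le> |B \<inter> [0, j)| \]
  (lemma \<open>column_passed_iff\<close>). For the complements the two sides become \<open>j + 1 - |A \<inter> [0, j]|\<close> and
  \<open>j - |B \<inter> [0, j)|\<close>. The extra \<open>1\<close> turns the inequality into its exact negation, so \<open>m\<close> becomes
  \<open>n - m\<close>.

  The sets \<open>A\<close> and \<open>B\<close> are represented below by their indicator lists, for which complementation
  is \<open>map Not\<close> and recursion along the path is available.
\<close>

section \<open>Encoding a path by the columns and rows of its peaks\<close>

fun peak_cols :: "step list \<Rightarrow> bool list" where
  "peak_cols [] = []"
| "peak_cols (D # w) = False # peak_cols w"
| "peak_cols (U # D # w) = True # peak_cols w"
| "peak_cols [U] = []"
| "peak_cols (U # U # w) = peak_cols (U # w)"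

fun peak_rows :: "step list \<Rightarrow> bool list" where
  "peak_rows [] = []"
| "peak_rows (D # w) = peak_rows w"
| "peak_rows (U # D # w) = True # peak_rows w"
| "peak_rows [U] = [False]"
| "peak_rows (U # U # w) = False # peak_rows (U # w)"

text \<open>
  A column without a peak is crossed at once. Before a column with a peak the path climbs through
  the next row with a peak, and once the columns are exhausted it climbs to the end. The fourth equation is only a default:
  it cannot be reached when the two lists contain equally many peaks.
\<close>

fun path_of :: "bool list \<Rightarrow> bool list \<Rightarrow> step list" where
  "path_of [] bs = map (\<lambda>_. U) bs"
| "path_of (False # as) bs = D # path_of as bs"
| "path_of (True # as) (False # bs) = U # path_of (True # as) bs"
| "path_of (True # as) [] = []"
| "path_of (True # as) (True # bs) = U # D # path_of as bs"

lemma length_peak_cols: "length (peak_cols w) = count_list w D"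
  by (induction w rule: peak_cols.induct) auto

lemma length_peak_rows: "length (peak_rows w) = count_list w U"
  by (induction w rule: peak_rows.induct) auto

lemma peak_cols_U: "peak_cols (U # w) = [] \<or> (\<exists>as. peak_cols (U # w) = True # as)"
  by (induction "U # w" arbitrary: w rule: peak_cols.induct) auto

lemma path_of_peaks: "path_of (peak_cols w) (peak_rows w) = w"
proof (induction w rule: peak_cols.induct)
  case (5 w)
  then show ?case using peak_cols_U[of w] by auto
qed auto

lemma peaks_path_of_no_cols:
  "True \<notin> set bs \<Longrightarrow>
    peak_cols (map (\<lambda>_. U) bs) = [] \<and> peak_rows (map (\<lambda>_. U) bs) = bs"
proof (induction bs)
  case (Cons b bs)
  then show ?case by (cases bs) auto
qed simp

lemma peaks_path_of:
  assumes "count_list as True = count_list bs True"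
  shows "peak_cols (path_of as bs) = as \<and> peak_rows (path_of as bs) = bs"
  using assms
proof (induction as bs rule: path_of.induct)
  case (1 bs)
  then have "True \<notin> set bs" by (simp add: count_list_0_iff)
  then show ?case using peaks_path_of_no_cols by simp
next
  case (3 as bs)
  \<comment> \<open>By the balance of the counts, \<open>bs\<close> still has a peak, so the rest of the path starts with \<open>U\<close>
    and the up step in front of it is no peak.\<close>
  then obtain v where "path_of (True # as) bs = U # v"
    by (cases bs) (auto, metis (full_types) path_of.simps(3,5))
  with 3 show ?case by auto
qed auto

section \<open>Reading off the statistics of a path\<close>

lemma peaks_Nil: "peaks [] = 0"
  by (simp add: peaks_def)

lemma peaks_Cons:
  "peaks (a # w) = (if a = U \<and> w \<noteq> [] \<and> hd w = D then Suc (peaks w) else peaks w)"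
proof -
  let ?S = "{i. Suc i < length w \<and> w ! i = U \<and> w ! Suc i = D}"
  let ?T = "{i. Suc i < length (a # w) \<and> (a # w) ! i = U \<and> (a # w) ! Suc i = D}"
  have "?T = (if a = U \<and> w \<noteq> [] \<and> hd w = D then insert 0 (Suc ` ?S) else Suc ` ?S)"
  proof (rule set_eqI)
    fix i
    show "i \<in> ?T \<longleftrightarrow>
        i \<in> (if a = U \<and> w \<noteq> [] \<and> hd w = D then insert 0 (Suc ` ?S) else Suc ` ?S)"
      by (cases i) (auto simp: hd_conv_nth image_iff)
  qed
  moreover have "finite ?S"
    by (rule finite_subset[of _ "{..<length w}"]) auto
  ultimately show ?thesis
    by (auto simp: peaks_def card_image)
qed

lemma peaks_conv_cols: "peaks w = count_list (peak_cols w) True"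
  by (induction w rule: peak_cols.induct) (auto simp: peaks_Nil peaks_Cons)

lemma peaks_conv_rows: "peaks w = count_list (peak_rows w) True"
  by (induction w rule: peak_rows.induct) (auto simp: peaks_Nil peaks_Cons)

lemma hd_eq_U_iff: "peak_cols w \<noteq> [] \<Longrightarrow> hd w = U \<longleftrightarrow> hd (peak_cols w)"
  by (induction w rule: peak_cols.induct) auto

lemma peak_rows_eq_Nil_last: "peak_rows w = [] \<Longrightarrow> w \<noteq> [] \<Longrightarrow> last w = D"
  by (induction w rule: peak_rows.induct) auto

lemma last_eq_D_iff: "peak_rows w \<noteq> [] \<Longrightarrow> last w = D \<longleftrightarrow> last (peak_rows w)"
proof (induction w rule: peak_rows.induct)
  case (3 w)
  then show ?case using peak_rows_eq_Nil_last[of w] by (cases "w = []") auto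
next
  case (5 w)
  moreover have "peak_rows (U # w) \<noteq> []"
    using length_peak_rows[of "U # w"] by auto
  ultimately show ?case by auto
qed auto

text \<open>
  Column \<open>t\<close> lies to the left of an up step iff all peaks in the columns up to \<open>t\<close> come before
  this step: if the step starts at \<open>x \<le> t\<close>, then the run of up steps containing it ends in a peak in
  column \<open>x\<close>, which is still to come. As peaks are traversed in order, it suffices to compare how
  many peaks lie in the columns up to \<open>t\<close> and how many lie in the rows below the step.
\<close>

lemma column_passed_iff:
  assumes "i < length w" "w ! i = U" "t < length (peak_cols w)"
  shows "t < count_list (take i w) D \<longleftrightarrow>
    count_list (take (Suc t) (peak_cols w)) True
      \<le> count_list (take (count_list (take i w) U) (peak_rows w)) True"
  using assms
proof (induction w arbitrary: i t rule: peak_cols.induct)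
  case (2 w)
  then obtain i' where i: "i = Suc i'" by (cases i) auto
  show ?case
  proof (cases t)
    case (Suc t')
    then show ?thesis using 2 i by auto
  qed (simp add: i)
next
  case (3 w)
  show ?case
  proof (cases "i = 0")
    case False
    with 3 obtain i' where i: "i = Suc (Suc i')"
      by (metis nth_Cons_0 nth_Cons_Suc not0_implies_Suc step.distinct(1))
    show ?thesis
    proof (cases t)
      case (Suc t')
      then show ?thesis using 3 i by auto
    qed (simp add: i)
  qed simp
next
  case (5 w)
  show ?case
  proof (cases i)
    case 0
    then show ?thesis using "5.IH"[of 0 t] "5.prems" by simp
  next
    case (Suc i')
    then show ?thesis using "5.IH"[of i' t] "5.prems" by simp
  qed
qed auto

lemma bij_betw_up_steps_rows:
  "bij_betw (\<lambda>i. count_list (take i w) U) {i. i < length w \<and> w ! i = U} {..<count_list w U}"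
proof -
  let ?S = "{i. i < length w \<and> w ! i = U}"
  have less: "count_list (take i w) U < count_list (take j w) U"
    if "i < j" "i \<in> ?S" "j \<le> length w" for i j
  proof -
    have "take j w = take i w @ w ! i # drop (Suc i) (take j w)"
      using that id_take_nth_drop[of i "take j w"] by (simp add: min_def)
    then have "count_list (take j w) U = count_list (take i w @ w ! i # drop (Suc i) (take j w)) U"
      by (rule arg_cong)
    then show ?thesis using that by simp
  qed
  have inj: "inj_on (\<lambda>i. count_list (take i w) U) ?S"
  proof (rule linorder_inj_onI)
    fix i j assume "i < j" "i \<in> ?S" "j \<in> ?S"
    then show "count_list (take i w) U \<noteq> count_list (take j w) U"
      using less[of i j] by simp
  qed auto
  have sub: "(\<lambda>i. count_list (take i w) U) ` ?S \<subseteq> {..<count_list w U}"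
    using less[of _ "length w"] by auto
  have "card ?S = count_list w U"
    by (simp add: count_list_eq_length_filter length_filter_conv_card eq_commute)
  with inj sub show ?thesis
    by (simp add: bij_betw_def card_image card_subset_eq)
qed

text \<open>On a balanced path every row \<open>j\<close> is also the index of a column, so \<open>column_passed_iff\<close>
  applies with \<open>t = j\<close>.\<close>

lemma ups_below_conv_peaks:
  assumes "w \<in> lattice_paths n"
  shows "ups_below w = card {j. j < n \<and>
    count_list (take (Suc j) (peak_cols w)) True \<le> count_list (take j (peak_rows w)) True}"
    (is "_ = card {j. j < n \<and> ?Q j}")
proof -
  let ?S = "{i. i < length w \<and> w ! i = U}"
  let ?row = "\<lambda>i. count_list (take i w) U"
  have n: "count_list w U = n" "count_list w D = n"
    using assms by (auto simp: lattice_paths_def vertex_def)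
  have bij: "bij_betw ?row ?S {..<n}"
    using bij_betw_up_steps_rows[of w] n by simp
  have eq: "?row i < count_list (take i w) D \<longleftrightarrow> ?Q (?row i)" if "i \<in> ?S" for i
    using that bij_betwE[OF bij] by (intro column_passed_iff) (auto simp: length_peak_cols n)
  have "ups_below w = card {i \<in> ?S. ?Q (?row i)}"
    unfolding ups_below_def vertex_def using eq by (intro arg_cong[where f = card]) auto
  also have "\<dots> = card (?row ` {i \<in> ?S. ?Q (?row i)})"
    using bij by (intro card_image[symmetric]) (auto simp: bij_betw_def inj_on_def)
  also have "?row ` {i \<in> ?S. ?Q (?row i)} = {j \<in> ?row ` ?S. ?Q j}"
    by blast
  also have "?row ` ?S = {..<n}"
    using bij by (rule bij_betw_imp_surj_on)
  finally show ?thesis by simp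
qed

section \<open>Complementing the peak columns and rows\<close>

definition complement_path :: "step list \<Rightarrow> step list" where
  "complement_path w = path_of (map Not (peak_cols w)) (map Not (peak_rows w))"

lemma count_True_map_Not:
  "count_list (map Not xs) True = length xs - count_list xs True"
proof -
  have "count_list (map Not xs) True + count_list xs True = length xs"
    by (induction xs) auto
  then show ?thesis by simp
qed

lemma count_list_take_le: "count_list (take j xs) x \<le> j"
  using count_le_length[of "take j xs" x] by simp

context
  fixes w :: "step list" and n :: nat
  assumes w: "w \<in> lattice_paths n"
begin

lemma lengths: "length (peak_cols w) = n" "length (peak_rows w) = n"
  using w by (auto simp: lattice_paths_def vertex_def length_peak_cols length_peak_rows)

text \<open>The complements of two sets of equal size again have equal size. This is where the path
  must contain as many up steps as down steps.\<close>

lemma peaks_complement_path: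
  "peak_cols (complement_path w) = map Not (peak_cols w)"
  "peak_rows (complement_path w) = map Not (peak_rows w)"
proof -
  have "count_list (map Not (peak_cols w)) True = count_list (map Not (peak_rows w)) True"
    by (simp add: count_True_map_Not lengths flip: peaks_conv_cols peaks_conv_rows)
  from peaks_path_of[OF this] show
    "peak_cols (complement_path w) = map Not (peak_cols w)"
    "peak_rows (complement_path w) = map Not (peak_rows w)"
    by (auto simp: complement_path_def)
qed

lemma complement_path_in_lattice_paths: "complement_path w \<in> lattice_paths n"
  by (simp add: lattice_paths_def vertex_def peaks_complement_path lengths
      flip: length_peak_cols length_peak_rows)

lemma complement_complement_path: "complement_path (complement_path w) = w"
  by (simp add: complement_path_def[of "complement_path w"] peaks_complement_path o_def
      path_of_peaks)

lemma peaks_complement: "peaks (complement_path w) = n - peaks w"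
  by (simp add: peaks_conv_cols peaks_complement_path count_True_map_Not lengths)

lemma ups_below_complement: "ups_below (complement_path w) = n - ups_below w"
proof -
  let ?Q = "\<lambda>v j. count_list (take (Suc j) (peak_cols v)) True
    \<le> count_list (take j (peak_rows v)) True"
  have neg: "?Q (complement_path w) j \<longleftrightarrow> \<not> ?Q w j" if "j < n" for j
    using that count_list_take_le[of "Suc j" "peak_cols w" True]
      count_list_take_le[of j "peak_rows w" True]
    by (auto simp: peaks_complement_path take_map count_True_map_Not lengths)
  have "ups_below (complement_path w) = card {j. j < n \<and> ?Q (complement_path w) j}"
    by (rule ups_below_conv_peaks[OF complement_path_in_lattice_paths])
  also have "{j. j < n \<and> ?Q (complement_path w) j} = {..<n} - {j. j < n \<and> ?Q w j}"
    using neg by auto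
  also have "card \<dots> = n - card {j. j < n \<and> ?Q w j}"
    by (subst card_Diff_subset) auto
  finally show ?thesis
    by (simp add: ups_below_conv_peaks[OF w])
qed

lemma ends_complement:
  assumes "1 \<le> n"
  shows "hd (complement_path w) = U \<longleftrightarrow> hd w = D"
    and "last (complement_path w) = U \<longleftrightarrow> last w = D"
proof -
  have ne: "peak_cols w \<noteq> []" "peak_rows w \<noteq> []"
    using lengths assms by auto
  have "hd (complement_path w) = U \<longleftrightarrow> \<not> hd w = U"
    using hd_eq_U_iff[of w] hd_eq_U_iff[of "complement_path w"] ne
    by (simp add: peaks_complement_path hd_map)
  then show "hd (complement_path w) = U \<longleftrightarrow> hd w = D"
    by (cases "hd w") auto
  have "last (complement_path w) = D \<longleftrightarrow> \<not> last w = D"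
    using last_eq_D_iff[of w] last_eq_D_iff[of "complement_path w"] ne
    by (simp add: peaks_complement_path last_map)
  then show "last (complement_path w) = U \<longleftrightarrow> last w = D"
    by (metis step.exhaust step.distinct(1))
qed

end

fun opposite :: "step \<Rightarrow> step" where
  "opposite U = D"
| "opposite D = U"

lemma opposite_opposite: "opposite (opposite A) = A"
  by (cases A) auto

lemma eq_opposite_iff: "(x = U \<longleftrightarrow> y = D) \<Longrightarrow> x = opposite y"
  by (cases x; cases y) auto

lemma complement_path_in_P:
  assumes "w \<in> P n m k"
  shows "complement_path w \<in> P n (n - m) (n - k)"
  using assms ups_below_complement[of w n] peaks_complement[of w n]
    complement_path_in_lattice_paths[of w n]
  by (auto simp: P_def dyck_paths_def)

lemma complement_path_in_P_ends:
  assumes "1 \<le> n" and w: "w \<in> P_ends A B n m k"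
  shows "complement_path w \<in> P_ends (opposite A) (opposite B) n (n - m) (n - k)"
proof -
  have lattice: "w \<in> lattice_paths n"
    using w by (simp add: P_ends_def P_def dyck_paths_def)
  have "complement_path w \<noteq> []"
    using length_lattice_path[OF complement_path_in_lattice_paths[OF lattice]] \<open>1 \<le> n\<close> by auto
  then show ?thesis
    using w complement_path_in_P[of w n m k] ends_complement[OF lattice \<open>1 \<le> n\<close>]
    by (auto simp: P_ends_def intro!: eq_opposite_iff)
qed

lemma p_complement:
  assumes "m \<le> n" "k \<le> n"
  shows "p n m k = p n (n - m) (n - k)"
proof -
  have "bij_betw complement_path (P n m k) (P n (n - m) (n - k))"
    using complement_path_in_P[of _ n m k] complement_path_in_P[of _ n "n - m" "n - k"] assms
    by (intro bij_betw_byWitness[where f' = complement_path])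
      (auto simp: P_def dyck_paths_def intro: complement_complement_path)
  then show ?thesis
    unfolding p_def by (rule bij_betw_same_card)
qed

lemma p_ends_complement:
  assumes "1 \<le> n" "m \<le> n" "k \<le> n"
  shows "p_ends A B n m k = p_ends (opposite A) (opposite B) n (n - m) (n - k)"
proof -
  let ?Q = "P_ends (opposite A) (opposite B) n (n - m) (n - k)"
  have "bij_betw complement_path (P_ends A B n m k) ?Q"
  proof (rule bij_betw_byWitness[where f' = complement_path])
    show "complement_path ` P_ends A B n m k \<subseteq> ?Q"
      using complement_path_in_P_ends[OF \<open>1 \<le> n\<close>] by blast
    show "complement_path ` ?Q \<subseteq> P_ends A B n m k"
      using complement_path_in_P_ends[OF \<open>1 \<le> n\<close>, of _ "opposite A" "opposite B" "n - m" "n - k"]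
        assms by (auto simp: opposite_opposite)
  qed (auto simp: P_ends_def P_def dyck_paths_def intro: complement_complement_path)
  then show ?thesis
    unfolding p_ends_def by (rule bij_betw_same_card)
qed

theorem corollary2:
  fixes n m k :: nat
  assumes "1 \<le> n" and "1 \<le> k" and "k \<le> n" and "m \<le> n"
  shows "p_ends U U n m k = p_ends D D n (n - m) (n - k)
    \<and> p_ends U D n m k = p_ends D U n (n - m) (n - k)
    \<and> p n m k = p n (n - m) (n - k)"
  using p_ends_complement[of n m k U U] p_ends_complement[of n m k U D] p_complement[of m n k]
    assms by simp

end
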